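(* (1) Let $(G,\oplus)$ be a Smarandache right (respectively left) Bol loop. If every $f,g$-principal isotope of $(G,\oplus)$ is a Smarandache $f,g$-principal isotope of $(G,\oplus)$, then $(G,\oplus)$ is universal, i.e. every loop isotopic to $(G,\oplus)$ is a Smarandache right (respectively left) Bol loop. (2) Conversely, if $(G,\oplus)$ is a universal Smarandache right Bol loop, then there is a non-trivial right Bol subloop $(S,\oplus)$ of $(G,\oplus)$ such that for all $f,g\in S$ $$\mathcal{T}_1=(R_gR_{f^\rho}^{-1},\;L_{g^\lambda}R_g^{-1}R_{f^\rho}L_f^{-1},\;R_g^{-1}R_{f^\rho})$$ is an autotopism of $(S,\oplus)$. Likewise, if $(G,\oplus)$ is a universal Smarandache left Bol loop, then there is a non-trivial left Bol subloop $(S,\oplus)$ of $(G,\oplus)$ such that for all $f,g\in S$ $$\mathcal{T}_2=(R_{f^\rho}L_f^{-1}L_{g^\lambda}R_g^{-1},\;L_fL_{g^\lambda}^{-1},\;L_f^{-1}L_{g^\lambda})$$ is an autotopism of $(S,\oplus)$.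
   Context: A right Bol loop satisfies $[(yx)z]x=y[(xz)x]$; a left Bol loop satisfies $[x(yx)]z=x[y(xz)]$. A Smarandache right (left) Bol loop is a loop with at least one non-trivial (more than one element) subloop that is a right (left) Bol loop. It is universal if every loop isotopic to it is again a Smarandache right (left) Bol loop. An S-subloop of a loop is a non-trivial subloop which is a group under the loop operation. Loops $(G,\oplus)$ and $(H,\otimes)$ are isotopic if there are bijections $A,B,C:G\to H$ with $xA\otimes yB=(x\oplus y)C$ for all $x,y\in G$. Maps are written on the right of their arguments and composed from left to right. $xR_g=x\oplus g$, $yL_f=f\oplus y$. With $e$ the identity element, $f^\rho$ and $g^\lambda$ are defined by $f\oplus f^\rho=e$ and $g^\lambda\oplus g=e$. An autotopism of $(S,\oplus)$ is a triple $(A,B,C)$ of bijections of $S$ with $xA\oplus yB=(x\oplus y)C$ for all $x,y\in S$; in such triples the translations are those of $(S,\oplus)$. For $f,g\in G$ the $f,g$-principal isotope of $(G,\oplus)$ is the loop $(G,\circ)$ with $xR_g\circ yL_f=x\oplus y$ for all $x,y\in G$. An $f,g$-principal isotope of $(G,\oplus)$ is any $(G,\circ)$ arising in this way from some $f,g\in G$. $(G,\circ)$ is a Smarandache $f,g$-principal isotope of $(G,\oplus)$ if there are an S-subloop $(S,\oplus)$ of $(G,\oplus)$ and elements $f,g\in S$ such that $xR_g\circ yL_f=x\oplus y$ for all $x,y\in G$; then $f,g$ are called S-elements. *)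

theory Defs
  imports "HOL-Algebra.Group"
begin

text \<open>Loops are carried by the monoid records of HOL-Algebra, without associativity.\<close>

locale loop =
  fixes G :: "('a, 'm) monoid_scheme" (structure)
  assumes m_closed: "\<lbrakk>x \<in> carrier G; y \<in> carrier G\<rbrakk> \<Longrightarrow> x \<otimes> y \<in> carrier G"
    and one_closed: "\<one> \<in> carrier G"
    and l_one: "x \<in> carrier G \<Longrightarrow> \<one> \<otimes> x = x"
    and r_one: "x \<in> carrier G \<Longrightarrow> x \<otimes> \<one> = x"
    and r_solve: "\<lbrakk>a \<in> carrier G; b \<in> carrier G\<rbrakk> \<Longrightarrow> \<exists>!x. x \<in> carrier G \<and> a \<otimes> x = b"
    and l_solve: "\<lbrakk>a \<in> carrier G; b \<in> carrier G\<rbrakk> \<Longrightarrow> \<exists>!y. y \<in> carrier G \<and> y \<otimes> a = b"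

locale right_bol_loop = loop +
  assumes right_bol:
    "\<lbrakk>x \<in> carrier G; y \<in> carrier G; z \<in> carrier G\<rbrakk>
      \<Longrightarrow> ((y \<otimes> x) \<otimes> z) \<otimes> x = y \<otimes> ((x \<otimes> z) \<otimes> x)"

locale left_bol_loop = loop +
  assumes left_bol:
    "\<lbrakk>x \<in> carrier G; y \<in> carrier G; z \<in> carrier G\<rbrakk>
      \<Longrightarrow> (x \<otimes> (y \<otimes> x)) \<otimes> z = x \<otimes> (y \<otimes> (x \<otimes> z))"

text \<open>The record of a subloop keeps the identity of the ambient loop. This is no restriction:
  the identity of a subloop is idempotent, and the only idempotent of a loop is its identity.\<close>

definition subloop :: "'a set \<Rightarrow> ('a, 'm) monoid_scheme \<Rightarrow> bool" where
  "subloop S G \<longleftrightarrow> S \<subseteq> carrier G \<and> loop (G\<lparr>carrier := S\<rparr>)"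

definition nontrivial_subloop :: "'a set \<Rightarrow> ('a, 'm) monoid_scheme \<Rightarrow> bool" where
  "nontrivial_subloop S G \<longleftrightarrow> subloop S G \<and> (\<exists>x\<in>S. \<exists>y\<in>S. x \<noteq> y)"

definition S_subloop :: "'a set \<Rightarrow> ('a, 'm) monoid_scheme \<Rightarrow> bool" where
  "S_subloop S G \<longleftrightarrow> nontrivial_subloop S G \<and> group (G\<lparr>carrier := S\<rparr>)"

definition smarandache_right_bol_loop :: "('a, 'm) monoid_scheme \<Rightarrow> bool" where
  "smarandache_right_bol_loop G \<longleftrightarrow>
    loop G \<and> (\<exists>S. nontrivial_subloop S G \<and> right_bol_loop (G\<lparr>carrier := S\<rparr>))"

definition smarandache_left_bol_loop :: "('a, 'm) monoid_scheme \<Rightarrow> bool" where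
  "smarandache_left_bol_loop G \<longleftrightarrow>
    loop G \<and> (\<exists>S. nontrivial_subloop S G \<and> left_bol_loop (G\<lparr>carrier := S\<rparr>))"

definition isotopism ::
  "('a, 'm) monoid_scheme \<Rightarrow> ('b, 'n) monoid_scheme \<Rightarrow> ('a \<Rightarrow> 'b) \<times> ('a \<Rightarrow> 'b) \<times> ('a \<Rightarrow> 'b) \<Rightarrow> bool"
  where
  "isotopism G H = (\<lambda>(A, B, C).
    bij_betw A (carrier G) (carrier H) \<and>
    bij_betw B (carrier G) (carrier H) \<and>
    bij_betw C (carrier G) (carrier H) \<and>
    (\<forall>x\<in>carrier G. \<forall>y\<in>carrier G. A x \<otimes>\<^bsub>H\<^esub> B y = C (x \<otimes>\<^bsub>G\<^esub> y)))"

definition isotopic :: "('a, 'm) monoid_scheme \<Rightarrow> ('b, 'n) monoid_scheme \<Rightarrow> bool" where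
  "isotopic G H \<longleftrightarrow> (\<exists>A B C. isotopism G H (A, B, C))"

definition autotopism ::
  "('a, 'm) monoid_scheme \<Rightarrow> ('a \<Rightarrow> 'a) \<times> ('a \<Rightarrow> 'a) \<times> ('a \<Rightarrow> 'a) \<Rightarrow> bool" where
  "autotopism G T \<longleftrightarrow> isotopism G G T"

text \<open>HOL cannot quantify over types inside a formula, so universality is relative to the type
  that holds the elements of the isotopes. The carrier of a loop isotopic to \<open>G\<close> is in
  bijection with that of \<open>G\<close>, so the element type of \<open>G\<close> already represents all isotopes
  up to isomorphism.\<close>

definition universal_smarandache_right_bol_loop ::
  "'b itself \<Rightarrow> ('a, 'm) monoid_scheme \<Rightarrow> bool" where
  "universal_smarandache_right_bol_loop _ G \<longleftrightarrow>
    smarandache_right_bol_loop G \<and>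
    (\<forall>H :: 'b monoid. loop H \<and> isotopic G H \<longrightarrow> smarandache_right_bol_loop H)"

definition universal_smarandache_left_bol_loop ::
  "'b itself \<Rightarrow> ('a, 'm) monoid_scheme \<Rightarrow> bool" where
  "universal_smarandache_left_bol_loop _ G \<longleftrightarrow>
    smarandache_left_bol_loop G \<and>
    (\<forall>H :: 'b monoid. loop H \<and> isotopic G H \<longrightarrow> smarandache_left_bol_loop H)"

definition rtrans :: "('a, 'm) monoid_scheme \<Rightarrow> 'a \<Rightarrow> 'a \<Rightarrow> 'a" where
  "rtrans G g = (\<lambda>x. x \<otimes>\<^bsub>G\<^esub> g)"

definition ltrans :: "('a, 'm) monoid_scheme \<Rightarrow> 'a \<Rightarrow> 'a \<Rightarrow> 'a" where
  "ltrans G f = (\<lambda>y. f \<otimes>\<^bsub>G\<^esub> y)"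

definition rtrans_inv :: "('a, 'm) monoid_scheme \<Rightarrow> 'a \<Rightarrow> 'a \<Rightarrow> 'a" where
  "rtrans_inv G g = inv_into (carrier G) (rtrans G g)"

definition ltrans_inv :: "('a, 'm) monoid_scheme \<Rightarrow> 'a \<Rightarrow> 'a \<Rightarrow> 'a" where
  "ltrans_inv G f = inv_into (carrier G) (ltrans G f)"

definition rho_inv :: "('a, 'm) monoid_scheme \<Rightarrow> 'a \<Rightarrow> 'a" where
  "rho_inv G f = (THE y. y \<in> carrier G \<and> f \<otimes>\<^bsub>G\<^esub> y = \<one>\<^bsub>G\<^esub>)"

definition lambda_inv :: "('a, 'm) monoid_scheme \<Rightarrow> 'a \<Rightarrow> 'a" where
  "lambda_inv G g = (THE y. y \<in> carrier G \<and> y \<otimes>\<^bsub>G\<^esub> g = \<one>\<^bsub>G\<^esub>)"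

definition principal_isotope ::
  "('a, 'm) monoid_scheme \<Rightarrow> 'a \<Rightarrow> 'a \<Rightarrow> ('a, 'n) monoid_scheme \<Rightarrow> bool" where
  "principal_isotope G f g P \<longleftrightarrow>
    loop P \<and> carrier P = carrier G \<and> f \<in> carrier G \<and> g \<in> carrier G \<and>
    (\<forall>x\<in>carrier G. \<forall>y\<in>carrier G. rtrans G g x \<otimes>\<^bsub>P\<^esub> ltrans G f y = x \<otimes>\<^bsub>G\<^esub> y)"

text \<open>The witnesses \<open>f\<close>, \<open>g\<close> are part of the notion: they need not be the pair by which \<open>P\<close> was
  first obtained as a principal isotope.\<close>

definition smarandache_principal_isotope ::
  "('a, 'm) monoid_scheme \<Rightarrow> ('a, 'n) monoid_scheme \<Rightarrow> bool" where
  "smarandache_principal_isotope G P \<longleftrightarrow>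
    (\<exists>S. S_subloop S G \<and> (\<exists>f\<in>S. \<exists>g\<in>S. principal_isotope G f g P))"

unbundle state_combinator_syntax

text \<open>The combinator \<open>\<circ>>\<close> composes from left to right, as for maps written on the right.\<close>

definition T1 ::
  "('a, 'm) monoid_scheme \<Rightarrow> 'a \<Rightarrow> 'a \<Rightarrow> ('a \<Rightarrow> 'a) \<times> ('a \<Rightarrow> 'a) \<times> ('a \<Rightarrow> 'a)" where
  "T1 G f g =
    (rtrans G g \<circ>> rtrans_inv G (rho_inv G f),
     ltrans G (lambda_inv G g) \<circ>> rtrans_inv G g \<circ>> rtrans G (rho_inv G f) \<circ>> ltrans_inv G f,
     rtrans_inv G g \<circ>> rtrans G (rho_inv G f))"

definition T2 ::
  "('a, 'm) monoid_scheme \<Rightarrow> 'a \<Rightarrow> 'a \<Rightarrow> ('a \<Rightarrow> 'a) \<times> ('a \<Rightarrow> 'a) \<times> ('a \<Rightarrow> 'a)" where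
  "T2 G f g =
    (rtrans G (rho_inv G f) \<circ>> ltrans_inv G f \<circ>> ltrans G (lambda_inv G g) \<circ>> rtrans_inv G g,
     ltrans G f \<circ>> ltrans_inv G (lambda_inv G g),
     ltrans_inv G f \<circ>> ltrans G (lambda_inv G g))"

unbundle no state_combinator_syntax

end

theory Submission
  imports Defs
begin

text \<open>A loop isotopic to \<open>G\<close> by \<open>(A, B, C)\<close> is isomorphic, via \<open>C\<close>, to a principal isotope \<open>P\<close> of \<open>G\<close>.
  When \<open>f\<close> and \<open>g\<close> lie in a subgroup \<open>S\<close> of \<open>G\<close>, the \<open>f,g\<close>-principal isotope restricts to \<open>S\<close> as
  \<open>x \<circ> y = x (fg)\<^sup>-\<^sup>1 y\<close>, a group isomorphic to \<open>S\<close> through \<open>x \<mapsto> x fg\<close>. Hence every isotope contains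
  a non-trivial group, which is both right and left Bol.

  In a right Bol loop the Bol identity says that \<open>\<beta>\<^sub>x = (R\<^sub>x\<^sup>-\<^sup>1, L\<^sub>x R\<^sub>x, R\<^sub>x)\<close> is an autotopism, and inverses
  are two-sided with \<open>R\<^sub>x\<^sup>-\<^sup>1\<close> the translation by the inverse of \<open>x\<close>. So \<open>T1\<close> is \<open>\<beta>\<close> at \<open>g\<^sup>-\<^sup>1\<close> followed by the
  inverse of \<open>\<beta>\<close> at \<open>f\<close>; \<open>T2\<close> is the mirror image of \<open>T1\<close> in the opposite loop.\<close>

section \<open>Loops and groups\<close>

context loop
begin

lemma r_cancel:
  assumes "y \<otimes> a = z \<otimes> a" "a \<in> carrier G" "y \<in> carrier G" "z \<in> carrier G"
  shows "y = z"
  using l_solve[of a "z \<otimes> a"] assms m_closed by blast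

lemma l_cancel:
  assumes "a \<otimes> y = a \<otimes> z" "a \<in> carrier G" "y \<in> carrier G" "z \<in> carrier G"
  shows "y = z"
  using r_solve[of a "a \<otimes> z"] assms m_closed by blast

text \<open>This later identifies the identity of a principal isotope.\<close>

lemma idempotent_imp_one:
  assumes "x \<otimes> x = x" "x \<in> carrier G"
  shows "x = \<one>"
  using l_cancel[of x x \<one>] assms r_one one_closed by simp

lemma bij_betw_rtrans:
  assumes "a \<in> carrier G"
  shows "bij_betw (rtrans G a) (carrier G) (carrier G)"
  unfolding bij_betw_def
proof
  show "inj_on (rtrans G a) (carrier G)"
    using assms r_cancel by (auto simp: inj_on_def rtrans_def)
  show "rtrans G a ` carrier G = carrier G"
  proof
    show "rtrans G a ` carrier G \<subseteq> carrier G"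
      using assms m_closed by (auto simp: rtrans_def)
    show "carrier G \<subseteq> rtrans G a ` carrier G"
    proof
      fix b assume "b \<in> carrier G"
      then obtain y where "y \<in> carrier G" "y \<otimes> a = b"
        using l_solve assms by blast
      then show "b \<in> rtrans G a ` carrier G"
        by (force simp: rtrans_def)
    qed
  qed
qed

lemma bij_betw_ltrans:
  assumes "a \<in> carrier G"
  shows "bij_betw (ltrans G a) (carrier G) (carrier G)"
  unfolding bij_betw_def
proof
  show "inj_on (ltrans G a) (carrier G)"
    using assms l_cancel by (auto simp: inj_on_def ltrans_def)
  show "ltrans G a ` carrier G = carrier G"
  proof
    show "ltrans G a ` carrier G \<subseteq> carrier G"
      using assms m_closed by (auto simp: ltrans_def)
    show "carrier G \<subseteq> ltrans G a ` carrier G"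
    proof
      fix b assume "b \<in> carrier G"
      then obtain y where "y \<in> carrier G" "a \<otimes> y = b"
        using r_solve assms by blast
      then show "b \<in> ltrans G a ` carrier G"
        by (force simp: ltrans_def)
    qed
  qed
qed

lemma rho_inv_props:
  assumes "f \<in> carrier G"
  shows "rho_inv G f \<in> carrier G" "f \<otimes> rho_inv G f = \<one>"
  using theI'[OF r_solve[OF assms one_closed]] by (simp_all add: rho_inv_def)

lemma lambda_inv_props:
  assumes "f \<in> carrier G"
  shows "lambda_inv G f \<in> carrier G" "lambda_inv G f \<otimes> f = \<one>"
  using theI'[OF l_solve[OF assms one_closed]] by (simp_all add: lambda_inv_def)

end

lemma (in group) is_loop: "loop G"
proof
  fix a b assume ab: "a \<in> carrier G" "b \<in> carrier G"
  show "\<exists>!x. x \<in> carrier G \<and> a \<otimes> x = b"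
    using ab by (intro ex1I[of _ "inv a \<otimes> b"]) (auto simp: inv_solve_left m_assoc[symmetric])
  show "\<exists>!y. y \<in> carrier G \<and> y \<otimes> a = b"
    using ab by (intro ex1I[of _ "b \<otimes> inv a"]) (auto simp: m_assoc)
qed auto

lemma (in group) is_right_bol_loop: "right_bol_loop G"
  using is_loop by (auto simp: right_bol_loop_def right_bol_loop_axioms_def m_assoc)

lemma (in group) is_left_bol_loop: "left_bol_loop G"
  using is_loop by (auto simp: left_bol_loop_def left_bol_loop_axioms_def m_assoc)

lemma S_subloop_imp_smarandache_bol:
  assumes "loop H" "S_subloop S H"
  shows "smarandache_right_bol_loop H" "smarandache_left_bol_loop H"
  using assms group.is_right_bol_loop group.is_left_bol_loop
  unfolding smarandache_right_bol_loop_def smarandache_left_bol_loop_def S_subloop_def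
  by blast+

section \<open>Isotopes\<close>

text \<open>Pulling the operation of \<open>H\<close> back along \<open>C\<close> gives a loop on
  the carrier of \<open>G\<close> for which \<open>C\<close> is an isomorphism. Following
  \<open>A\<close> and \<open>B\<close> by the inverse of \<open>C\<close> turns them into
  translations of \<open>G\<close>.\<close>

lemma isotope_iso_principal_isotope:
  fixes G :: "('a, 'm) monoid_scheme" and H :: "('b, 'n) monoid_scheme"
  assumes "loop G" "loop H" "isotopic G H"
  obtains P :: "'a monoid" and f g C
  where "principal_isotope G f g P" "C \<in> iso P H" "C \<one>\<^bsub>P\<^esub> = \<one>\<^bsub>H\<^esub>"
proof -
  interpret G: loop G by fact
  interpret H: loop H by fact
  obtain A B C where A: "bij_betw A (carrier G) (carrier H)"
    and B: "bij_betw B (carrier G) (carrier H)"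
    and C: "bij_betw C (carrier G) (carrier H)"
    and AB: "\<And>x y. \<lbrakk>x \<in> carrier G; y \<in> carrier G\<rbrakk> \<Longrightarrow> A x \<otimes>\<^bsub>H\<^esub> B y = C (x \<otimes>\<^bsub>G\<^esub> y)"
    using assms(3) unfolding isotopic_def isotopism_def by auto
  define D where "D = inv_into (carrier G) C"
  have D: "bij_betw D (carrier H) (carrier G)"
    unfolding D_def by (rule bij_betw_inv_into[OF C])
  have CD: "C (D u) = u" if "u \<in> carrier H" for u
    unfolding D_def by (rule bij_betw_inv_into_right[OF C that])
  have DC: "D (C x) = x" if "x \<in> carrier G" for x
    unfolding D_def by (rule bij_betw_inv_into_left[OF C that])
  have in_H: "A x \<in> carrier H" "B x \<in> carrier H" "C x \<in> carrier H" if "x \<in> carrier G" for x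
    using bij_betwE[OF A] bij_betwE[OF B] bij_betwE[OF C] that by auto
  have in_G: "D u \<in> carrier G" if "u \<in> carrier H" for u
    using bij_betwE[OF D] that by auto
  define P :: "'a monoid" where
    "P = \<lparr>carrier = carrier G, mult = (\<lambda>x y. D (C x \<otimes>\<^bsub>H\<^esub> C y)), one = D \<one>\<^bsub>H\<^esub>\<rparr>"
  have P_sel: "carrier P = carrier G" "\<one>\<^bsub>P\<^esub> = D \<one>\<^bsub>H\<^esub>" "x \<otimes>\<^bsub>P\<^esub> y = D (C x \<otimes>\<^bsub>H\<^esub> C y)" for x y
    by (simp_all add: P_def)
  have P: "loop P"
  proof
    fix a b assume "a \<in> carrier P" "b \<in> carrier P"
    then have ab: "a \<in> carrier G" "b \<in> carrier G" by (simp_all add: P_sel)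
    \<comment> \<open>Both division problems in \<open>P\<close> are solved in \<open>H\<close> and
      their solutions carried back along \<open>D\<close>.\<close>
    have eq: "D u = b \<longleftrightarrow> u = C b" if "u \<in> carrier H" for u
      using CD[OF that] DC[OF ab(2)] by metis
    obtain u where u: "u \<in> carrier H" "C a \<otimes>\<^bsub>H\<^esub> u = C b"
      and u': "\<And>v. \<lbrakk>v \<in> carrier H; C a \<otimes>\<^bsub>H\<^esub> v = C b\<rbrakk> \<Longrightarrow> v = u"
      using H.r_solve[OF in_H(3)[OF ab(1)] in_H(3)[OF ab(2)]] by blast
    show "\<exists>!x. x \<in> carrier P \<and> a \<otimes>\<^bsub>P\<^esub> x = b"
    proof (rule ex1I[of _ "D u"])
      fix x assume "x \<in> carrier P \<and> a \<otimes>\<^bsub>P\<^esub> x = b"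
      then have "x \<in> carrier G" "C x = u"
        using u'[of "C x"] eq[of "C a \<otimes>\<^bsub>H\<^esub> C x"] in_H ab H.m_closed DC by (simp_all add: P_sel)
      then show "x = D u" using DC[of x] by simp
    qed (simp add: P_sel u in_G CD DC ab)
    obtain w where w: "w \<in> carrier H" "w \<otimes>\<^bsub>H\<^esub> C a = C b"
      and w': "\<And>v. \<lbrakk>v \<in> carrier H; v \<otimes>\<^bsub>H\<^esub> C a = C b\<rbrakk> \<Longrightarrow> v = w"
      using H.l_solve[OF in_H(3)[OF ab(1)] in_H(3)[OF ab(2)]] by blast
    show "\<exists>!y. y \<in> carrier P \<and> y \<otimes>\<^bsub>P\<^esub> a = b"
    proof (rule ex1I[of _ "D w"])
      fix y assume "y \<in> carrier P \<and> y \<otimes>\<^bsub>P\<^esub> a = b"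
      then have "y \<in> carrier G" "C y = w"
        using w'[of "C y"] eq[of "C y \<otimes>\<^bsub>H\<^esub> C a"] in_H ab H.m_closed DC by (simp_all add: P_sel)
      then show "y = D w" using DC[of y] by simp
    qed (simp add: P_sel w in_G CD DC ab)
  qed (simp_all add: P_sel in_G in_H H.m_closed H.one_closed H.l_one H.r_one CD DC)
  \<comment> \<open>With these preimages of the identity, putting \<open>y = g\<close> or
    \<open>x = f\<close> in \<open>AB\<close> shows that \<open>A\<close> is right translation by
    \<open>g\<close> followed by \<open>C\<close>, and \<open>B\<close> is left translation by
    \<open>f\<close> followed by \<open>C\<close>.\<close>
  obtain f where f: "f \<in> carrier G" "A f = \<one>\<^bsub>H\<^esub>"
    using A H.one_closed by (metis bij_betw_iff_bijections)
  obtain g where g: "g \<in> carrier G" "B g = \<one>\<^bsub>H\<^esub>"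
    using B H.one_closed by (metis bij_betw_iff_bijections)
  have A_eq: "C (x \<otimes>\<^bsub>G\<^esub> g) = A x" and B_eq: "C (f \<otimes>\<^bsub>G\<^esub> x) = B x" if "x \<in> carrier G" for x
    using AB[of x g] AB[of f x] f g that in_H H.l_one H.r_one by auto
  have "principal_isotope G f g P"
    unfolding principal_isotope_def
    using P f g A_eq B_eq AB DC G.m_closed by (auto simp: P_sel rtrans_def ltrans_def)
  moreover have "C \<in> iso P H"
    using C in_H H.m_closed CD by (auto simp: iso_def hom_def P_sel)
  moreover have "C \<one>\<^bsub>P\<^esub> = \<one>\<^bsub>H\<^esub>"
    using CD H.one_closed by (simp add: P_sel)
  ultimately show thesis by (rule that)
qed

text \<open>The same set \<open>S\<close> serves. Since \<open>f\<close> and \<open>g\<close> lie in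
  the group on \<open>S\<close>, right translation by their product stays in \<open>S\<close> and
  carries the group structure over to the operation of \<open>P\<close>.\<close>

lemma smarandache_principal_isotope_S_subloop:
  assumes "smarandache_principal_isotope G P"
  obtains S where "S_subloop S P"
proof -
  obtain S f g where S: "S_subloop S G" and fg: "f \<in> S" "g \<in> S"
    and iso: "principal_isotope G f g P"
    using assms unfolding smarandache_principal_isotope_def by auto
  let ?K = "G\<lparr>carrier := S\<rparr>" and ?Q = "P\<lparr>carrier := S\<rparr>"
  interpret K: group ?K using S by (simp add: S_subloop_def)
  interpret P: loop P using iso by (simp add: principal_isotope_def)
  have sub: "S \<subseteq> carrier G" and nt: "\<exists>x\<in>S. \<exists>y\<in>S. x \<noteq> y"
    using S by (auto simp: S_subloop_def nontrivial_subloop_def subloop_def)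
  have mult_P: "(x \<otimes>\<^bsub>?K\<^esub> g) \<otimes>\<^bsub>P\<^esub> (f \<otimes>\<^bsub>?K\<^esub> y) = x \<otimes>\<^bsub>?K\<^esub> y" if "x \<in> S" "y \<in> S" for x y
    using iso that sub by (auto simp: principal_isotope_def rtrans_def ltrans_def)
  have in_K: "f \<in> carrier ?K" "g \<in> carrier ?K" using fg by simp_all
  define c where "c = f \<otimes>\<^bsub>?K\<^esub> g"
  have c: "c \<in> carrier ?K" unfolding c_def using in_K by (rule K.m_closed)
  \<comment> \<open>This is the isotopy equation at \<open>x = f\<close>,
    \<open>y = g\<close>.\<close>
  have "c \<otimes>\<^bsub>P\<^esub> c = c"
    unfolding c_def using mult_P[OF fg] .
  then have c_one: "c = \<one>\<^bsub>P\<^esub>"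
    using P.idempotent_imp_one c sub iso by (auto simp: principal_isotope_def)
  let ?h = "\<lambda>x. x \<otimes>\<^bsub>?K\<^esub> c"
  have hom: "?h x \<otimes>\<^bsub>P\<^esub> ?h y = ?h (x \<otimes>\<^bsub>?K\<^esub> y)" if "x \<in> carrier ?K" "y \<in> carrier ?K" for x y
  proof -
    have "?h x = (x \<otimes>\<^bsub>?K\<^esub> f) \<otimes>\<^bsub>?K\<^esub> g"
      unfolding c_def using that in_K K.m_assoc by simp
    \<comment> \<open>The left factor is now a right multiple of \<open>g\<close> and the right
      factor a left multiple of \<open>f\<close>, the form that \<open>mult_P\<close>
      requires.\<close>
    moreover have "?h y = f \<otimes>\<^bsub>?K\<^esub> (inv\<^bsub>?K\<^esub> f \<otimes>\<^bsub>?K\<^esub> ?h y)"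
      using that in_K c by (metis K.inv_closed K.l_one K.m_assoc K.m_closed K.r_inv)
    ultimately have "?h x \<otimes>\<^bsub>P\<^esub> ?h y = (x \<otimes>\<^bsub>?K\<^esub> f) \<otimes>\<^bsub>?K\<^esub> (inv\<^bsub>?K\<^esub> f \<otimes>\<^bsub>?K\<^esub> ?h y)"
      using mult_P[of "x \<otimes>\<^bsub>?K\<^esub> f" "inv\<^bsub>?K\<^esub> f \<otimes>\<^bsub>?K\<^esub> ?h y"] that in_K c
        K.m_closed K.inv_closed by simp
    also have "\<dots> = x \<otimes>\<^bsub>?K\<^esub> ?h y"
      using that in_K c by (metis K.inv_closed K.l_one K.m_assoc K.m_closed K.r_inv)
    also have "\<dots> = ?h (x \<otimes>\<^bsub>?K\<^esub> y)"
      using that c by (rule K.m_assoc[symmetric])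
    finally show ?thesis .
  qed
  have "bij_betw ?h (carrier ?K) (carrier ?K)"
    using loop.bij_betw_rtrans[OF K.is_loop c] by (simp add: rtrans_def)
  then have "?h \<in> iso ?K ?Q"
    using hom c K.m_closed by (auto simp: iso_def hom_def)
  \<comment> \<open>The library fact resets the identity field to the image of the old identity.
    That image is \<open>c\<close>, already the identity of \<open>P\<close>, so the record is
    unchanged.\<close>
  from K.iso_imp_img_group[OF this] have "group (?Q\<lparr>one := \<one>\<^bsub>?K\<^esub> \<otimes>\<^bsub>?K\<^esub> c\<rparr>)" .
  moreover have "?Q\<lparr>one := \<one>\<^bsub>?K\<^esub> \<otimes>\<^bsub>?K\<^esub> c\<rparr> = ?Q"
    using K.l_one[OF c] c_one by simp
  ultimately have Q: "group ?Q" by simp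
  have "S_subloop S P"
    using Q group.is_loop[OF Q] nt sub iso
    by (auto simp: S_subloop_def nontrivial_subloop_def subloop_def principal_isotope_def)
  then show thesis by (rule that)
qed

text \<open>\<open>iso\<close> speaks only of carriers and multiplication; the equation between
  identities makes the image group carry the identity of \<open>H\<close>.\<close>

lemma S_subloop_iso_image:
  assumes "S_subloop S P" "C \<in> iso P H" "C \<one>\<^bsub>P\<^esub> = \<one>\<^bsub>H\<^esub>"
  shows "S_subloop (C ` S) H"
proof -
  let ?K = "P\<lparr>carrier := S\<rparr>" and ?Q = "H\<lparr>carrier := C ` S\<rparr>"
  interpret K: group ?K using assms(1) by (simp add: S_subloop_def)
  have sub: "S \<subseteq> carrier P" and nt: "\<exists>x\<in>S. \<exists>y\<in>S. x \<noteq> y"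
    using assms(1) by (auto simp: S_subloop_def nontrivial_subloop_def subloop_def)
  have C: "inj_on C (carrier P)" "C ` carrier P = carrier H"
    "\<And>x y. \<lbrakk>x \<in> carrier P; y \<in> carrier P\<rbrakk> \<Longrightarrow> C (x \<otimes>\<^bsub>P\<^esub> y) = C x \<otimes>\<^bsub>H\<^esub> C y"
    using assms(2) by (auto simp: iso_def hom_def bij_betw_def)
  have "C \<in> iso ?K ?Q"
    using C(3) sub inj_on_subset[OF C(1) sub] by (simp add: iso_def hom_def bij_betw_def subset_iff)
  from K.iso_imp_img_group[OF this] have Q: "group ?Q"
    using assms(3) by simp
  have "\<exists>x\<in>C ` S. \<exists>y\<in>C ` S. x \<noteq> y"
    using nt C(1) sub by (auto simp: inj_on_def) (metis subsetD)
  then show ?thesis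
    using Q group.is_loop[OF Q] C(2) sub
    by (auto simp: S_subloop_def nontrivial_subloop_def subloop_def)
qed

text \<open>This serves the right and the left case alike, as a group satisfies both Bol
  identities.\<close>

lemma isotope_has_S_subloop:
  fixes G :: "('a, 'm) monoid_scheme" and H :: "('b, 'n) monoid_scheme"
  assumes "loop G" "loop H" "isotopic G H"
    and principal: "\<And>P :: 'a monoid. \<exists>f\<in>carrier G. \<exists>g\<in>carrier G. principal_isotope G f g P
      \<Longrightarrow> smarandache_principal_isotope G P"
  obtains S where "S_subloop S H"
proof -
  obtain P :: "'a monoid" and f g C where P: "principal_isotope G f g P"
    and C: "C \<in> iso P H" "C \<one>\<^bsub>P\<^esub> = \<one>\<^bsub>H\<^esub>"
    using assms(1-3) by (rule isotope_iso_principal_isotope)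
  have "smarandache_principal_isotope G P"
    using P by (intro principal) (auto simp: principal_isotope_def)
  then obtain S where "S_subloop S P"
    by (rule smarandache_principal_isotope_S_subloop)
  then show thesis
    using that S_subloop_iso_image C by blast
qed

section \<open>Autotopisms of Bol loops\<close>

context right_bol_loop
begin

text \<open>The right inverse property: with \<open>z\<close> the right inverse of \<open>x\<close>,
  the Bol identity reduces to an equation from which \<open>x\<close> cancels on the right.\<close>

lemma mult_mult_rho_inv:
  assumes "x \<in> carrier G" "y \<in> carrier G"
  shows "(y \<otimes> x) \<otimes> rho_inv G x = y"
proof (rule r_cancel[of _ x])
  note r = rho_inv_props[OF assms(1)]
  show "((y \<otimes> x) \<otimes> rho_inv G x) \<otimes> x = y \<otimes> x"
    using right_bol[OF assms r(1)] r(2) l_one[OF assms(1)] by simp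
qed (use assms rho_inv_props m_closed in auto)

text \<open>Take \<open>y\<close> to be the left inverse of \<open>x\<close> in the right inverse
  property.\<close>

lemma lambda_inv_eq_rho_inv:
  assumes "x \<in> carrier G"
  shows "lambda_inv G x = rho_inv G x"
  using mult_mult_rho_inv[OF assms lambda_inv_props(1)[OF assms]] lambda_inv_props[OF assms]
    rho_inv_props[OF assms] l_one by simp

lemma rho_inv_rho_inv:
  assumes "x \<in> carrier G"
  shows "rho_inv G (rho_inv G x) = x"
proof (rule l_cancel[of "rho_inv G x"])
  show "rho_inv G x \<otimes> rho_inv G (rho_inv G x) = rho_inv G x \<otimes> x"
    using assms lambda_inv_eq_rho_inv lambda_inv_props rho_inv_props by metis
qed (use assms rho_inv_props in auto)

lemma mult_rho_inv_mult:
  assumes "x \<in> carrier G" "y \<in> carrier G"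
  shows "(y \<otimes> rho_inv G x) \<otimes> x = y"
  using mult_mult_rho_inv[of "rho_inv G x" y] assms rho_inv_props rho_inv_rho_inv by simp

text \<open>This turns each \<open>rtrans_inv\<close> in \<open>T1\<close> into a multiplication;
  the inverse left translation keeps its \<open>inv_into\<close> form.\<close>

lemma rtrans_inv_eq:
  assumes "x \<in> carrier G" "y \<in> carrier G"
  shows "rtrans_inv G x y = y \<otimes> rho_inv G x"
proof -
  have "y \<otimes> rho_inv G x \<in> carrier G" "rtrans G x (y \<otimes> rho_inv G x) = y"
    using assms rho_inv_props m_closed mult_rho_inv_mult by (simp_all add: rtrans_def)
  then show ?thesis
    using bij_betw_inv_into_left[OF bij_betw_rtrans[OF assms(1)]]
    unfolding rtrans_inv_def by metis
qed

lemma autotopism_T1: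
  assumes f: "f \<in> carrier G" and g: "g \<in> carrier G"
  shows "autotopism G (T1 G f g)"
proof -
  let ?f' = "rho_inv G f" and ?g' = "rho_inv G g"
  have f': "?f' \<in> carrier G" and g': "?g' \<in> carrier G"
    using f g by (auto intro: rho_inv_props)
  have bij_inv: "bij_betw (rtrans_inv G a) (carrier G) (carrier G)"
    "bij_betw (ltrans_inv G a) (carrier G) (carrier G)" if "a \<in> carrier G" for a
    unfolding rtrans_inv_def ltrans_inv_def
    using bij_betw_inv_into bij_betw_rtrans bij_betw_ltrans that by blast+
  note bij = bij_betw_rtrans bij_betw_ltrans bij_inv
  \<comment> \<open>The second component of \<open>T1\<close>, with its inverse right translation
    written as multiplication by \<open>?g'\<close>.\<close>
  let ?B = "\<lambda>y. ltrans_inv G f (((?g' \<otimes> y) \<otimes> ?g') \<otimes> ?f')"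
  have key: "((x \<otimes> g) \<otimes> f) \<otimes> ?B y = ((x \<otimes> y) \<otimes> ?g') \<otimes> ?f'"
    if x: "x \<in> carrier G" and y: "y \<in> carrier G" for x y
  \<comment> \<open>A further factor \<open>f\<close> on the right lets the Bol identity at
    \<open>f\<close> apply, which brings \<open>?B y\<close> next to \<open>f\<close> and undoes the
    left division.\<close>
  proof (rule r_cancel[of _ f])
    let ?u = "(?g' \<otimes> y) \<otimes> ?g'"
    have u: "?u \<in> carrier G" "?u \<otimes> ?f' \<in> carrier G"
      using f' g' y m_closed by auto
    have B: "?B y \<in> carrier G" "f \<otimes> ?B y = ?u \<otimes> ?f'"
      using bij_betwE[OF bij_inv(2)[OF f]] u
        bij_betw_inv_into_right[OF bij_betw_ltrans[OF f] u(2)]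
      by (auto simp: ltrans_inv_def ltrans_def)
    have "(((x \<otimes> g) \<otimes> f) \<otimes> ?B y) \<otimes> f = (x \<otimes> g) \<otimes> ((f \<otimes> ?B y) \<otimes> f)"
      using x f g B m_closed by (intro right_bol) auto
    also have "\<dots> = (x \<otimes> g) \<otimes> ?u"
      using B u f mult_rho_inv_mult by simp
    \<comment> \<open>The second use of the Bol identity is at \<open>?g'\<close>, read from right
      to left; then \<open>g\<close> and \<open>?g'\<close> cancel.\<close>
    also have "\<dots> = (((x \<otimes> g) \<otimes> ?g') \<otimes> y) \<otimes> ?g'"
      using x y g g' m_closed by (intro right_bol[symmetric]) auto
    also have "\<dots> = (x \<otimes> y) \<otimes> ?g'"
      using x g mult_mult_rho_inv by simp
    also have "\<dots> = (((x \<otimes> y) \<otimes> ?g') \<otimes> ?f') \<otimes> f"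
      using x y g' f m_closed mult_rho_inv_mult by simp
    finally show "(((x \<otimes> g) \<otimes> f) \<otimes> ?B y) \<otimes> f = (((x \<otimes> y) \<otimes> ?g') \<otimes> ?f') \<otimes> f" .
    show "((x \<otimes> g) \<otimes> f) \<otimes> ?B y \<in> carrier G"
      using x f g B m_closed by auto
  qed (use x y f f' g' m_closed in auto)
  show ?thesis
    unfolding T1_def autotopism_def isotopism_def prod.case fcomp_comp
  proof (intro conjI ballI)
    fix x y assume x: "x \<in> carrier G" and y: "y \<in> carrier G"
    \<comment> \<open>\<open>fcomp_comp\<close> rewrites the left-to-right composites with
      \<open>\<circ>\<close>, so the factors appear in reverse order.\<close>
    show "(rtrans_inv G ?f' \<circ> rtrans G g) x \<otimes>
        (ltrans_inv G f \<circ> (rtrans G ?f' \<circ> (rtrans_inv G g \<circ> ltrans G (lambda_inv G g)))) y =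
        (rtrans G ?f' \<circ> rtrans_inv G g) (x \<otimes> y)"
      using key[OF x y] x y f g f' g' m_closed
      by (simp add: rtrans_inv_eq rtrans_def ltrans_def rho_inv_rho_inv lambda_inv_eq_rho_inv)
  qed (use f g f' g' lambda_inv_props in \<open>auto intro!: bij_betw_trans bij\<close>)
qed

end

section \<open>Opposite loops and the left Bol case\<close>

definition opposite :: "('a, 'm) monoid_scheme \<Rightarrow> ('a, 'm) monoid_scheme" where
  "opposite G = G\<lparr>mult := (\<lambda>x y. y \<otimes>\<^bsub>G\<^esub> x)\<rparr>"

lemma opposite_sel [simp]:
  "carrier (opposite G) = carrier G" "\<one>\<^bsub>opposite G\<^esub> = \<one>\<^bsub>G\<^esub>" "x \<otimes>\<^bsub>opposite G\<^esub> y = y \<otimes>\<^bsub>G\<^esub> x"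
  by (simp_all add: opposite_def)

lemma (in loop) loop_opposite: "loop (opposite G)"
  by unfold_locales (use m_closed one_closed l_one r_one r_solve l_solve in auto)

text \<open>Reversing all products in the left Bol identity, with \<open>y\<close> and
  \<open>z\<close> exchanged, gives the right Bol identity with its sides swapped.\<close>

lemma (in left_bol_loop) right_bol_loop_opposite: "right_bol_loop (opposite G)"
  using loop_opposite left_bol
  by (simp add: right_bol_loop_def right_bol_loop_axioms_def)

lemma autotopism_opposite:
  "autotopism (opposite G) (A, B, C) \<longleftrightarrow> autotopism G (B, A, C)"
  by (auto simp: autotopism_def isotopism_def)

text \<open>Passing to the opposite loop exchanges left with right translations and left with right
  inverses; \<open>f\<close> and \<open>g\<close> change places accordingly.\<close>

lemma T1_opposite:
  "T1 (opposite G) g f = (case T2 G f g of (A, B, C) \<Rightarrow> (B, A, C))"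
proof -
  have "rtrans (opposite G) = ltrans G" "ltrans (opposite G) = rtrans G"
    by (simp_all add: fun_eq_iff rtrans_def ltrans_def)
  moreover from this have "rtrans_inv (opposite G) = ltrans_inv G"
    "ltrans_inv (opposite G) = rtrans_inv G"
    by (simp_all add: rtrans_inv_def[abs_def] ltrans_inv_def[abs_def])
  moreover have "rho_inv (opposite G) = lambda_inv G" "lambda_inv (opposite G) = rho_inv G"
    by (simp_all add: fun_eq_iff rho_inv_def lambda_inv_def)
  ultimately show ?thesis
    by (simp add: T1_def T2_def)
qed

lemma (in left_bol_loop) autotopism_T2:
  assumes "f \<in> carrier G" "g \<in> carrier G"
  shows "autotopism G (T2 G f g)"
  using right_bol_loop.autotopism_T1[OF right_bol_loop_opposite, of g f] assms
  by (cases "T2 G f g") (simp add: T1_opposite autotopism_opposite)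

theorem theorem3p3:
  fixes G :: "('a, 'm) monoid_scheme"
  shows
    "(smarandache_right_bol_loop G \<and>
        (\<forall>P :: 'a monoid. (\<exists>f\<in>carrier G. \<exists>g\<in>carrier G. principal_isotope G f g P)
           \<longrightarrow> smarandache_principal_isotope G P)
      \<longrightarrow> universal_smarandache_right_bol_loop TYPE('b) G)
   \<and> (smarandache_left_bol_loop G \<and>
        (\<forall>P :: 'a monoid. (\<exists>f\<in>carrier G. \<exists>g\<in>carrier G. principal_isotope G f g P)
           \<longrightarrow> smarandache_principal_isotope G P)
      \<longrightarrow> universal_smarandache_left_bol_loop TYPE('b) G)
   \<and> (universal_smarandache_right_bol_loop TYPE('a) G
      \<longrightarrow> (\<exists>S. nontrivial_subloop S G \<and> right_bol_loop (G\<lparr>carrier := S\<rparr>) \<and>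
            (\<forall>f\<in>S. \<forall>g\<in>S. autotopism (G\<lparr>carrier := S\<rparr>) (T1 (G\<lparr>carrier := S\<rparr>) f g))))
   \<and> (universal_smarandache_left_bol_loop TYPE('a) G
      \<longrightarrow> (\<exists>S. nontrivial_subloop S G \<and> left_bol_loop (G\<lparr>carrier := S\<rparr>) \<and>
            (\<forall>f\<in>S. \<forall>g\<in>S. autotopism (G\<lparr>carrier := S\<rparr>) (T2 (G\<lparr>carrier := S\<rparr>) f g))))"
proof (intro conjI impI)
  assume *: "smarandache_right_bol_loop G \<and>
    (\<forall>P :: 'a monoid. (\<exists>f\<in>carrier G. \<exists>g\<in>carrier G. principal_isotope G f g P)
      \<longrightarrow> smarandache_principal_isotope G P)"
  then have "loop G" by (simp add: smarandache_right_bol_loop_def)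
  then show "universal_smarandache_right_bol_loop TYPE('b) G"
    unfolding universal_smarandache_right_bol_loop_def
    \<comment> \<open>The non-trivial group found in each isotope is its right Bol subloop.\<close>
    using * by (metis isotope_has_S_subloop S_subloop_imp_smarandache_bol(1))
next
  assume *: "smarandache_left_bol_loop G \<and>
    (\<forall>P :: 'a monoid. (\<exists>f\<in>carrier G. \<exists>g\<in>carrier G. principal_isotope G f g P)
      \<longrightarrow> smarandache_principal_isotope G P)"
  then have "loop G" by (simp add: smarandache_left_bol_loop_def)
  then show "universal_smarandache_left_bol_loop TYPE('b) G"
    unfolding universal_smarandache_left_bol_loop_def
    using * by (metis isotope_has_S_subloop S_subloop_imp_smarandache_bol(2))
next
  assume "universal_smarandache_right_bol_loop TYPE('a) G"
  then obtain S where "nontrivial_subloop S G" "right_bol_loop (G\<lparr>carrier := S\<rparr>)"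
    unfolding universal_smarandache_right_bol_loop_def smarandache_right_bol_loop_def by blast
  then show "\<exists>S. nontrivial_subloop S G \<and> right_bol_loop (G\<lparr>carrier := S\<rparr>) \<and>
      (\<forall>f\<in>S. \<forall>g\<in>S. autotopism (G\<lparr>carrier := S\<rparr>) (T1 (G\<lparr>carrier := S\<rparr>) f g))"
    \<comment> \<open>The autotopism lemma is applied inside \<open>S\<close>, so translations and
      inverses are those of the subloop.\<close>
    using right_bol_loop.autotopism_T1[of "G\<lparr>carrier := S\<rparr>"] by auto
next
  assume "universal_smarandache_left_bol_loop TYPE('a) G"
  then obtain S where "nontrivial_subloop S G" "left_bol_loop (G\<lparr>carrier := S\<rparr>)"
    unfolding universal_smarandache_left_bol_loop_def smarandache_left_bol_loop_def by blast
  then show "\<exists>S. nontrivial_subloop S G \<and> left_bol_loop (G\<lparr>carrier := S\<rparr>) \<and>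
      (\<forall>f\<in>S. \<forall>g\<in>S. autotopism (G\<lparr>carrier := S\<rparr>) (T2 (G\<lparr>carrier := S\<rparr>) f g))"
    using left_bol_loop.autotopism_T2[of "G\<lparr>carrier := S\<rparr>"] by auto
qed

end
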